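(* Fix positive integers $n$ and $k$. Then, as $p$ tends to infinity through the prime numbers, $$\lim_{p\to\infty} \frac{|\mathrm{Diag}_n(\mathbb{Z}_{p^k})|}{|M_n(\mathbb{Z}_{p^k})|} = \frac{1}{n!}.$$
   Context: $\mathbb{Z}_{p^k}$ denotes the ring of integers modulo $p^k$, and $M_n(\mathbb{Z}_{p^k})$ the set of $n\times n$ matrices over it. A matrix $A\in M_n(\mathbb{Z}_{p^k})$ is diagonalizable over $\mathbb{Z}_{p^k}$ if $A = PDP^{-1}$ for some invertible $P\in GL_n(\mathbb{Z}_{p^k})$ and some diagonal $D\in M_n(\mathbb{Z}_{p^k})$. $\mathrm{Diag}_n(\mathbb{Z}_{p^k})$ denotes the set of all $n\times n$ matrices over $\mathbb{Z}_{p^k}$ that are diagonalizable over $\mathbb{Z}_{p^k}$. *)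

theory Defs
  imports Complex_Main "HOL-Computational_Algebra.Primes" "Jordan_Normal_Form.Matrix"
begin

text \<open>The modulus varies inside a limit, so the ring of integers modulo \<open>m\<close> cannot be a type.
  Its elements are represented by their least non-negative residues, the integers in
  \<open>{0..<m}\<close>, which makes the representing matrix unique, so that counting matrices
  over the ring is counting integer matrices of this form.  Sums and products are computed over the
  integers and then reduced.\<close>

definition mat_zmod :: "nat \<Rightarrow> nat \<Rightarrow> int mat set" where
  "mat_zmod n m = {A \<in> carrier_mat n n. \<forall>i<n. \<forall>j<n. A $$ (i, j) \<in> {0..<int m}}"

definition reduce_mat :: "nat \<Rightarrow> int mat \<Rightarrow> int mat" where
  "reduce_mat m A = map_mat (\<lambda>x. x mod int m) A"

definition mult_zmod :: "nat \<Rightarrow> int mat \<Rightarrow> int mat \<Rightarrow> int mat" where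
  "mult_zmod m A B = reduce_mat m (A * B)"

text \<open>The identity matrix is reduced as well, so that the definitions are also correct over the
  zero ring, \<open>m = 1\<close>.\<close>

definition inverse_zmod :: "nat \<Rightarrow> nat \<Rightarrow> int mat \<Rightarrow> int mat \<Rightarrow> bool" where
  "inverse_zmod n m P Q \<longleftrightarrow> P \<in> mat_zmod n m \<and> Q \<in> mat_zmod n m \<and>
     mult_zmod m P Q = reduce_mat m (1\<^sub>m n) \<and> mult_zmod m Q P = reduce_mat m (1\<^sub>m n)"

definition diagonalizable_zmod :: "nat \<Rightarrow> nat \<Rightarrow> int mat \<Rightarrow> bool" where
  "diagonalizable_zmod n m A \<longleftrightarrow>
     (\<exists>P Q D. inverse_zmod n m P Q \<and> D \<in> mat_zmod n m \<and> diagonal_mat D \<and>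
        A = mult_zmod m (mult_zmod m P D) Q)"

definition Diag_zmod :: "nat \<Rightarrow> nat \<Rightarrow> int mat set" where
  "Diag_zmod n m = {A \<in> mat_zmod n m. diagonalizable_zmod n m A}"

end

theory Submission
  imports Defs "Jordan_Normal_Form.Determinant" "HOL-Number_Theory.Cong"
begin

text \<open>Write \<open>m = p\<^sup>k\<close> and let \<open>u\<close> be the number of units modulo \<open>m\<close>.  The diagonalizable matrices are
  the values of \<open>(P, D) \<mapsto> P D P\<^sup>-\<^sup>1\<close>.  Multiplying \<open>P\<close> on the right by an invertible diagonal matrix
  does not change the value, so every fibre has at least \<open>u\<^sup>n\<close> elements.  If the entries of \<open>D\<close> are
  pairwise distinct, permuting the columns of \<open>P\<close> brings them into increasing order; if they are even
  distinct modulo \<open>p\<close> and increasing, the fibre is exactly one orbit of this torus action.  Only a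
  fraction \<open>O(1/p)\<close> of the \<open>D\<close> have two entries congruent modulo \<open>p\<close>, and only a fraction \<open>O(1/p)\<close> of
  all matrices are not invertible.  Hence the density of diagonalizable matrices differs from
  \<open>(m choose n) / u\<^sup>n\<close> by \<open>O(1/p)\<close>, and \<open>u / m = 1 - O(1/p)\<close>.\<close>

section \<open>Counting\<close>

text \<open>The fibres partition \<open>X\<close>. This serves the upper bound for diagonalizable
  matrices, where every fibre contains a torus orbit.\<close>

lemma fibre_card_mult_image_le:
  assumes "finite X" and "\<And>x. x \<in> X \<Longrightarrow> c \<le> card {y \<in> X. f y = f x}"
  shows "c * card (f ` X) \<le> card X"
proof -
  have "c * card (f ` X) = (\<Sum>a\<in>f ` X. c)" by simp
  also have "\<dots> \<le> (\<Sum>a\<in>f ` X. card {y \<in> X. f y = a})"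
    by (rule sum_mono) (use assms(2) in auto)
  also have "\<dots> = card X"
    using sum.image_gen[OF assms(1), of "\<lambda>_. 1::nat" f] by simp
  finally show ?thesis .
qed

text \<open>The opposite estimate, for the lower bound, where every fibre is contained in a single
  torus orbit.\<close>

lemma card_le_fibre_card_mult_image:
  assumes "finite X" and "\<And>x. x \<in> X \<Longrightarrow> card {y \<in> X. f y = f x} \<le> c"
  shows "card X \<le> c * card (f ` X)"
proof -
  have "card X = (\<Sum>a\<in>f ` X. card {y \<in> X. f y = a})"
    using sum.image_gen[OF assms(1), of "\<lambda>_. 1::nat" f] by simp
  also have "\<dots> \<le> (\<Sum>a\<in>f ` X. c)"
    by (rule sum_mono) (use assms(2) in auto)
  finally show ?thesis by (simp add: mult.commute)
qed

text \<open>Fubini: a function is its restriction away from \<open>a\<close> together with its value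
  at \<open>a\<close>, so a bound on each line in direction \<open>a\<close> sums to a global one.
  It is applied with \<open>r = p\<close> to conditions that fix one coordinate modulo
  \<open>p\<close>.\<close>

lemma card_PiE_le_of_lines:
  assumes I: "finite I" "a \<in> I" and V: "finite V"
    and line: "\<And>h. h \<in> I - {a} \<rightarrow>\<^sub>E V \<Longrightarrow> r * card {v \<in> V. R (h(a := v))} \<le> card V"
  shows "r * card {g \<in> I \<rightarrow>\<^sub>E V. R g} \<le> card V ^ card I"
proof -
  let ?J = "I - {a}"
  let ?S = "SIGMA h : ?J \<rightarrow>\<^sub>E V. {v \<in> V. R (h(a := v))}"
  have fin: "finite (?J \<rightarrow>\<^sub>E V)" using I V by (simp add: finite_PiE)
  have finS: "finite ?S" using fin V by auto
  have "{g \<in> I \<rightarrow>\<^sub>E V. R g} \<subseteq> (\<lambda>(h, v). h(a := v)) ` ?S"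
  proof
    fix g assume g: "g \<in> {g \<in> I \<rightarrow>\<^sub>E V. R g}"
    have eq: "g = (restrict g ?J)(a := g a)"
      using g by (auto simp: fun_eq_iff PiE_def extensional_def)
    have "restrict g ?J \<in> ?J \<rightarrow>\<^sub>E V" "g a \<in> V" using g I by auto
    moreover have "R ((restrict g ?J)(a := g a))" using g eq by simp
    ultimately have "(restrict g ?J, g a) \<in> ?S" by auto
    then show "g \<in> (\<lambda>(h, v). h(a := v)) ` ?S" using eq by (metis (no_types, lifting) case_prod_conv image_eqI)
  qed
  then have "card {g \<in> I \<rightarrow>\<^sub>E V. R g} \<le> card ?S"
    using surj_card_le[OF finS] by blast
  also have "\<dots> = (\<Sum>h\<in>?J \<rightarrow>\<^sub>E V. card {v \<in> V. R (h(a := v))})"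
    using fin V by (intro card_SigmaI) auto
  finally have "r * card {g \<in> I \<rightarrow>\<^sub>E V. R g} \<le> (\<Sum>h\<in>?J \<rightarrow>\<^sub>E V. r * card {v \<in> V. R (h(a := v))})"
    by (simp flip: sum_distrib_left)
  also have "\<dots> \<le> (\<Sum>h\<in>?J \<rightarrow>\<^sub>E V. card V)" by (rule sum_mono) (rule line)
  also have "\<dots> = card V ^ Suc (card ?J)" using I by (simp add: card_PiE)
  also have "\<dots> = card V ^ card I" by (simp only: card.remove[OF I, symmetric])
  finally show ?thesis .
qed

text \<open>With a common residue modulo \<open>p\<close>, the elements of \<open>S\<close> are told
  apart by their quotients by \<open>p\<close>, and only \<open>q\<close> quotients are
  possible.\<close>

lemma card_same_residue_le:
  fixes p q :: nat and S :: "int set"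
  assumes "p > 0" "S \<subseteq> {0..<int (p * q)}" and "\<And>v w. v \<in> S \<Longrightarrow> w \<in> S \<Longrightarrow> int p dvd v - w"
  shows "p * card S \<le> p * q"
proof -
  have "inj_on (\<lambda>v. v div int p) S"
  proof (rule inj_onI)
    fix v w assume vw: "v \<in> S" "w \<in> S" "v div int p = w div int p"
    have "v mod int p = w mod int p" using assms(3)[OF vw(1,2)] by (simp add: mod_eq_dvd_iff)
    then show "v = w" using vw(3) by (metis div_mult_mod_eq)
  qed
  moreover have "(\<lambda>v. v div int p) ` S \<subseteq> {0..<int q}"
  proof (rule image_subsetI)
    fix v assume "v \<in> S"
    then have v: "0 \<le> v" "v < int p * int q" using assms(2) by auto
    moreover have "int p * (v div int p) \<le> v"
      using mult_div_mod_eq[of "int p" v] pos_mod_sign[of "int p" v] assms(1) by linarith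
    ultimately have "int p * (v div int p) < int p * int q" by linarith
    then have "v div int p < int q" using assms(1) by simp
    then show "v div int p \<in> {0..<int q}" using v assms(1) by (simp add: pos_imp_zdiv_nonneg_iff)
  qed
  ultimately have "card S \<le> card {0..<int q}" by (rule card_inj_on_le) simp
  then show ?thesis by simp
qed

section \<open>Singular matrices and coinciding residues are rare\<close>

text \<open>Laplace expansion along the last column: the varied entry occurs in one summand only,
  and its cofactor is the smaller leading minor, with sign \<open>+1\<close>.\<close>

lemma det_leading_block_update:
  fixes g :: "nat \<times> nat \<Rightarrow> int"
  shows "\<exists>c. \<forall>v. det (mat (Suc j) (Suc j) (g((j, j) := v))) = v * det (mat j j g) + c"
proof -
  let ?A = "\<lambda>v. mat (Suc j) (Suc j) (g((j, j) := v))"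
  let ?c = "\<Sum>i<j. ?A 0 $$ (i, j) * cofactor (?A 0) i j"
  have "det (?A v) = v * det (mat j j g) + ?c" for v
  proof -
    have "det (?A v) = (\<Sum>i<Suc j. ?A v $$ (i, j) * cofactor (?A v) i j)"
      by (rule laplace_expansion_column) auto
    also have "\<dots> = (\<Sum>i<j. ?A v $$ (i, j) * cofactor (?A v) i j) + v * cofactor (?A v) j j"
      by simp
    also have "(\<Sum>i<j. ?A v $$ (i, j) * cofactor (?A v) i j) = ?c"
    proof (rule sum.cong[OF refl])
      fix i assume "i \<in> {..<j}"
      then have i: "i < j" by simp
      \<comment> \<open>Deleting column \<open>j\<close> removes the only entry that depends on
        \<open>v\<close>.\<close>
      have "mat_delete (?A v) i j = mat_delete (?A 0) i j"
        by (rule eq_matI) (auto simp: mat_delete_def)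
      then show "?A v $$ (i, j) * cofactor (?A v) i j = ?A 0 $$ (i, j) * cofactor (?A 0) i j"
        using i by (simp add: cofactor_def)
    qed
    also have "mat_delete (?A v) j j = mat j j g"
      by (rule eq_matI) (auto simp: mat_delete_def)
    then have "cofactor (?A v) j j = det (mat j j g)" by (simp add: cofactor_def)
    finally show ?thesis by (simp only: add.commute)
  qed
  then show ?thesis by blast
qed

text \<open>If \<open>p\<close> divides the determinant, it divides a first leading principal minor, of size
  \<open>j + 1\<close> say.  That minor is affine in the entry \<open>(j, j)\<close>, with slope the leading minor of size \<open>j\<close>,
  so this entry is determined modulo \<open>p\<close> by the others.\<close>

lemma card_det_dvd_le:
  fixes p q n :: nat
  assumes p: "prime p"
  defines "W \<equiv> ({..<n} \<times> {..<n}) \<rightarrow>\<^sub>E {0..<int (p * q)}"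
  shows "p * card {g \<in> W. int p dvd det (mat n n g)} \<le> n * (p * q) ^ (n * n)"
proof -
  let ?I = "{..<n} \<times> {..<n}" and ?V = "{0..<int (p * q)}"
  let ?R = "\<lambda>j g. \<not> int p dvd det (mat j j g) \<and> int p dvd det (mat (Suc j) (Suc j) g)"
  have V: "card ?V = p * q" by (simp add: nat_mult_distrib)
  have finW: "finite W" unfolding W_def by (simp add: finite_PiE)
  have p': "prime (int p)" using p by simp
  have sub: "{g \<in> W. int p dvd det (mat n n g)} \<subseteq> (\<Union>j<n. {g \<in> W. ?R j g})"
  proof
    fix g assume g: "g \<in> {g \<in> W. int p dvd det (mat n n g)}"
    let ?P = "\<lambda>j. int p dvd det (mat j j g)"
    \<comment> \<open>The empty determinant is 1, so divisibility by \<open>p\<close> has to start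
      at some size between 1 and \<open>n\<close>.\<close>
    have "\<not> ?P 0" using p' not_prime_unit by fastforce
    moreover have "?P n" using g by simp
    ultimately obtain k where "k < n" "\<not> ?P k" "?P (Suc k)"
      using ex_least_nat_less[of ?P n] by blast
    then show "g \<in> (\<Union>j<n. {g \<in> W. ?R j g})" using g by blast
  qed
  have each: "p * card {g \<in> W. ?R j g} \<le> (p * q) ^ (n * n)" if j: "j < n" for j
  proof -
    have "p * card {g \<in> W. ?R j g} \<le> card ?V ^ card ?I"
      unfolding W_def
    proof (rule card_PiE_le_of_lines[where a = "(j, j)"])
      fix h :: "nat \<times> nat \<Rightarrow> int"
      obtain c where c: "\<And>v. det (mat (Suc j) (Suc j) (h((j, j) := v))) = v * det (mat j j h) + c"
        using det_leading_block_update[of j h] by blast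
      \<comment> \<open>The block of size \<open>j\<close> does not contain position
        \<open>(j, j)\<close>, so the slope depends on \<open>h\<close> alone and is the same along
        the whole line.\<close>
      have minor: "mat j j (h((j, j) := v)) = mat j j h" for v
        by (rule eq_matI) auto
      have "p * card {v \<in> ?V. ?R j (h((j, j) := v))} \<le> p * q"
      proof (rule card_same_residue_le)
        fix v w assume "v \<in> {v \<in> ?V. ?R j (h((j, j) := v))}" "w \<in> {v \<in> ?V. ?R j (h((j, j) := v))}"
        then have nd: "\<not> int p dvd det (mat j j h)"
          and "int p dvd v * det (mat j j h) + c" "int p dvd w * det (mat j j h) + c"
          by (auto simp: minor c)
        then have "int p dvd (v * det (mat j j h) + c) - (w * det (mat j j h) + c)"
          using dvd_diff by blast
        then have "int p dvd (v - w) * det (mat j j h)" by (simp add: algebra_simps)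
        then show "int p dvd v - w" using nd p' prime_dvd_multD by blast
      qed (use p in \<open>auto simp: prime_gt_0_nat\<close>)
      then show "p * card {v \<in> ?V. ?R j (h((j, j) := v))} \<le> card ?V" unfolding V .
    qed (use j in auto)
    then show ?thesis unfolding V by (simp add: card_cartesian_product)
  qed
  have "card {g \<in> W. int p dvd det (mat n n g)} \<le> card (\<Union>j<n. {g \<in> W. ?R j g})"
    using finW by (intro card_mono sub) auto
  also have "\<dots> \<le> (\<Sum>j<n. card {g \<in> W. ?R j g})" by (rule card_UN_le) simp
  finally have "p * card {g \<in> W. int p dvd det (mat n n g)} \<le> (\<Sum>j<n. p * card {g \<in> W. ?R j g})"
    unfolding sum_distrib_left[symmetric] by (rule mult_le_mono2)
  also have "\<dots> \<le> (\<Sum>j<n. (p * q) ^ (n * n))" by (rule sum_mono) (rule each, simp)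
  also have "\<dots> = n * (p * q) ^ (n * n)" by simp
  finally show ?thesis .
qed

text \<open>Collisions are taken modulo \<open>p\<close>, although the entries live modulo
  \<open>m\<close>: a difference that is nonzero modulo \<open>m\<close> may still be a zero
  divisor, and the lower bound needs unit differences.\<close>

definition residue_collisions :: "nat \<Rightarrow> nat \<Rightarrow> nat \<Rightarrow> (nat \<Rightarrow> int) set" where
  "residue_collisions p m n =
     {g \<in> {..<n} \<rightarrow>\<^sub>E {0..<int m}. \<exists>i<n. \<exists>j<n. i \<noteq> j \<and> int p dvd g i - g j}"

lemma finite_residue_collisions: "finite (residue_collisions p m n)"
  by (simp add: residue_collisions_def finite_PiE)

text \<open>Union bound over pairs of positions: for a fixed pair of distinct positions, the value
  at the first is determined modulo \<open>p\<close> by the value at the second.\<close>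

lemma card_residue_collisions_le:
  assumes "p > 0"
  shows "p * card (residue_collisions p (p * q) n) \<le> n * n * (p * q) ^ n"
proof -
  let ?V = "{0..<int (p * q)}"
  let ?W = "{..<n} \<rightarrow>\<^sub>E ?V"
  let ?IJ = "{..<n} \<times> {..<n}"
  let ?R = "\<lambda>ij g. fst ij \<noteq> snd ij \<and> int p dvd (g (fst ij) :: int) - g (snd ij)"
  have V: "card ?V = p * q" by (simp add: nat_mult_distrib)
  have finW: "finite ?W" by (simp add: finite_PiE)
  have each: "p * card {g \<in> ?W. ?R ij g} \<le> (p * q) ^ n" if "ij \<in> ?IJ" for ij
  proof (cases "fst ij = snd ij")
    case False
    have "p * card {g \<in> ?W. ?R ij g} \<le> card ?V ^ card {..<n}"
    proof (rule card_PiE_le_of_lines[where a = "fst ij"])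
      fix h :: "nat \<Rightarrow> int"
      have "p * card {v \<in> ?V. ?R ij (h(fst ij := v))} \<le> p * q"
      proof (rule card_same_residue_le)
        fix v w assume "v \<in> {v \<in> ?V. ?R ij (h(fst ij := v))}" "w \<in> {v \<in> ?V. ?R ij (h(fst ij := v))}"
        then have "int p dvd v - h (snd ij)" "int p dvd w - h (snd ij)" using False by auto
        from dvd_diff[OF this] show "int p dvd v - w" by simp
      qed (use assms in auto)
      then show "p * card {v \<in> ?V. ?R ij (h(fst ij := v))} \<le> card ?V" unfolding V .
    qed (use that in auto)
    then show ?thesis unfolding V by simp
  qed simp
  have "residue_collisions p (p * q) n \<subseteq> (\<Union>ij\<in>?IJ. {g \<in> ?W. ?R ij g})"
    by (force simp: residue_collisions_def)
  then have "card (residue_collisions p (p * q) n) \<le> card (\<Union>ij\<in>?IJ. {g \<in> ?W. ?R ij g})"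
    using finW by (intro card_mono) auto
  also have "\<dots> \<le> (\<Sum>ij\<in>?IJ. card {g \<in> ?W. ?R ij g})" by (rule card_UN_le) simp
  finally have "p * card (residue_collisions p (p * q) n) \<le> (\<Sum>ij\<in>?IJ. p * card {g \<in> ?W. ?R ij g})"
    unfolding sum_distrib_left[symmetric] by (rule mult_le_mono2)
  also have "\<dots> \<le> (\<Sum>ij\<in>?IJ. (p * q) ^ n)" by (rule sum_mono) (rule each)
  also have "\<dots> = n * n * (p * q) ^ n" by (simp add: card_cartesian_product)
  finally show ?thesis .
qed

section \<open>The monoid of matrices modulo \<open>m\<close>\<close>

text \<open>Packaging the matrices as a monoid makes its \<open>Units\<close> the general linear
  group and supplies inverses and cancellation from the algebra library.\<close>

definition zmod_mats :: "nat \<Rightarrow> nat \<Rightarrow> int mat monoid" where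
  "zmod_mats n m = \<lparr>carrier = mat_zmod n m, mult = mult_zmod m, one = reduce_mat m (1\<^sub>m n)\<rparr>"

lemma zmod_mats_simps [simp]:
  "carrier (zmod_mats n m) = mat_zmod n m"
  "mult (zmod_mats n m) = mult_zmod m"
  "one (zmod_mats n m) = reduce_mat m (1\<^sub>m n)"
  by (simp_all add: zmod_mats_def)

lemma mat_zmodD: "A \<in> mat_zmod n m \<Longrightarrow> A \<in> carrier_mat n n"
  by (simp add: mat_zmod_def)

lemma reduce_mat_carrier [simp]: "reduce_mat m A \<in> carrier_mat a b \<longleftrightarrow> A \<in> carrier_mat a b"
  by (simp add: reduce_mat_def)

lemma reduce_mat_index:
  "A \<in> carrier_mat a b \<Longrightarrow> i < a \<Longrightarrow> j < b \<Longrightarrow> reduce_mat m A $$ (i, j) = A $$ (i, j) mod int m"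
  by (simp add: reduce_mat_def)

lemma reduce_mat_in: "m > 0 \<Longrightarrow> A \<in> carrier_mat n n \<Longrightarrow> reduce_mat m A \<in> mat_zmod n m"
  by (auto simp: mat_zmod_def reduce_mat_index)

lemma reduce_mat_id: "A \<in> mat_zmod n m \<Longrightarrow> reduce_mat m A = A"
  by (rule eq_matI) (auto simp: mat_zmod_def reduce_mat_def)

lemma mult_index_sum:
  fixes A B :: "int mat"
  assumes "A \<in> carrier_mat n n" "B \<in> carrier_mat n n" "i < n" "j < n"
  shows "(A * B) $$ (i, j) = (\<Sum>k<n. A $$ (i, k) * B $$ (k, j))"
  using assms by (simp add: scalar_prod_def atLeast0LessThan)

lemma mult_zmod_index:
  assumes "A \<in> carrier_mat n n" "B \<in> carrier_mat n n" "i < n" "j < n"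
  shows "mult_zmod m A B $$ (i, j) = (\<Sum>k<n. A $$ (i, k) * B $$ (k, j)) mod int m"
  using assms mult_index_sum[OF assms]
  by (simp add: mult_zmod_def reduce_mat_index[of "A * B" n n])

text \<open>Reducing a factor beforehand changes each summand of an entry only by a multiple of
  \<open>m\<close>. Associativity of the reduced product rests on this and its mirror image.\<close>

lemma mult_zmod_reduce_left:
  assumes A: "A \<in> carrier_mat n n" and B: "B \<in> carrier_mat n n"
  shows "mult_zmod m (reduce_mat m A) B = mult_zmod m A B"
proof (rule eq_matI)
  fix i j assume "i < dim_row (mult_zmod m A B)" "j < dim_col (mult_zmod m A B)"
  then have ij: "i < n" "j < n" using A B by (auto simp: mult_zmod_def reduce_mat_def)
  have rA: "reduce_mat m A \<in> carrier_mat n n" using A by simp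
  have "(\<Sum>k<n. (A $$ (i, k) mod int m) * B $$ (k, j)) mod int m
      = (\<Sum>k<n. ((A $$ (i, k) mod int m) * B $$ (k, j)) mod int m) mod int m"
    by (rule mod_sum_eq[symmetric])
  also have "\<dots> = (\<Sum>k<n. A $$ (i, k) * B $$ (k, j)) mod int m"
    by (simp add: mod_mult_left_eq mod_sum_eq)
  finally show "mult_zmod m (reduce_mat m A) B $$ (i, j) = mult_zmod m A B $$ (i, j)"
    using ij A by (simp add: mult_zmod_index[OF rA B] mult_zmod_index[OF A B] reduce_mat_index[OF A])
qed (use A B in \<open>auto simp: mult_zmod_def reduce_mat_def\<close>)

lemma mult_zmod_reduce_right:
  assumes A: "A \<in> carrier_mat n n" and B: "B \<in> carrier_mat n n"
  shows "mult_zmod m A (reduce_mat m B) = mult_zmod m A B"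
proof (rule eq_matI)
  fix i j assume "i < dim_row (mult_zmod m A B)" "j < dim_col (mult_zmod m A B)"
  then have ij: "i < n" "j < n" using A B by (auto simp: mult_zmod_def reduce_mat_def)
  have rB: "reduce_mat m B \<in> carrier_mat n n" using B by simp
  have "(\<Sum>k<n. A $$ (i, k) * (B $$ (k, j) mod int m)) mod int m
      = (\<Sum>k<n. (A $$ (i, k) * (B $$ (k, j) mod int m)) mod int m) mod int m"
    by (rule mod_sum_eq[symmetric])
  also have "\<dots> = (\<Sum>k<n. A $$ (i, k) * B $$ (k, j)) mod int m"
    by (simp add: mod_mult_right_eq mod_sum_eq)
  finally show "mult_zmod m A (reduce_mat m B) $$ (i, j) = mult_zmod m A B $$ (i, j)"
    using ij B by (simp add: mult_zmod_index[OF A rB] mult_zmod_index[OF A B] reduce_mat_index[OF B])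
qed (use A B in \<open>auto simp: mult_zmod_def reduce_mat_def\<close>)

lemma mult_zmod_in:
  "m > 0 \<Longrightarrow> A \<in> mat_zmod n m \<Longrightarrow> B \<in> mat_zmod n m \<Longrightarrow> mult_zmod m A B \<in> mat_zmod n m"
  unfolding mult_zmod_def by (intro reduce_mat_in mult_carrier_mat[of _ n n]) (auto dest: mat_zmodD)

lemma monoid_zmod_mats:
  assumes m: "m > 0"
  shows "monoid (zmod_mats n m)"
proof (rule monoidI)
  fix A B C
  assume "A \<in> carrier (zmod_mats n m)" "B \<in> carrier (zmod_mats n m)" "C \<in> carrier (zmod_mats n m)"
  then have "A \<in> carrier_mat n n" "B \<in> carrier_mat n n" "C \<in> carrier_mat n n"
    by (auto dest: mat_zmodD)
  moreover from this have "mult_zmod m (A * B) C = mult_zmod m A (B * C)"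
    by (simp add: mult_zmod_def)
  ultimately show "mult (zmod_mats n m) (mult (zmod_mats n m) A B) C
      = mult (zmod_mats n m) A (mult (zmod_mats n m) B C)"
    by (simp add: mult_zmod_def[of m A B] mult_zmod_def[of m B C]
        mult_zmod_reduce_left[of _ n] mult_zmod_reduce_right[of _ n])
next
  fix A assume "A \<in> carrier (zmod_mats n m)"
  then have A: "A \<in> mat_zmod n m" "A \<in> carrier_mat n n" by (auto dest: mat_zmodD)
  show "mult (zmod_mats n m) (one (zmod_mats n m)) A = A"
    using A mult_zmod_reduce_left[of "1\<^sub>m n" n A m]
    by (simp add: mult_zmod_def[of m "1\<^sub>m n"] reduce_mat_id[of A n])
  show "mult (zmod_mats n m) A (one (zmod_mats n m)) = A"
    using A mult_zmod_reduce_right[of A n "1\<^sub>m n" m]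
    by (simp add: mult_zmod_def[of m A "1\<^sub>m n"] reduce_mat_id[of A n])
qed (use m in \<open>auto intro: mult_zmod_in reduce_mat_in\<close>)

text \<open>Inverses in a monoid are unique, so \<open>Q\<close> carries no information beyond
  \<open>P\<close>, and conjugations can be counted by \<open>P\<close> alone.\<close>

lemma inverse_zmod_iff:
  assumes m: "m > 0"
  shows "inverse_zmod n m P Q \<longleftrightarrow> P \<in> Units (zmod_mats n m) \<and> Q = inv\<^bsub>zmod_mats n m\<^esub> P"
proof -
  interpret monoid "zmod_mats n m" by (rule monoid_zmod_mats[OF m])
  show ?thesis
  proof
    assume "inverse_zmod n m P Q"
    then have PQ: "P \<in> mat_zmod n m" "Q \<in> mat_zmod n m" "mult_zmod m P Q = reduce_mat m (1\<^sub>m n)"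
      "mult_zmod m Q P = reduce_mat m (1\<^sub>m n)" by (auto simp: inverse_zmod_def)
    then have P: "P \<in> Units (zmod_mats n m)" by (auto simp: Units_def)
    moreover have "Q = inv\<^bsub>zmod_mats n m\<^esub> P"
      using inv_unique[of "Q" P "inv\<^bsub>zmod_mats n m\<^esub> P"] PQ P Units_r_inv[OF P] Units_inv_closed[OF P] by simp
    ultimately show "P \<in> Units (zmod_mats n m) \<and> Q = inv\<^bsub>zmod_mats n m\<^esub> P" by simp
  next
    assume PQ: "P \<in> Units (zmod_mats n m) \<and> Q = inv\<^bsub>zmod_mats n m\<^esub> P"
    then show "inverse_zmod n m P Q"
      using Units_closed[of P] Units_inv_closed[of P] Units_r_inv[of P] Units_l_inv[of P]
      by (simp add: inverse_zmod_def)
  qed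
qed

section \<open>Counting all matrices and the invertible ones\<close>

lemma mat_eq_iff_index:
  "mat n n f = mat n n g \<longleftrightarrow> (\<forall>i<n. \<forall>j<n. f (i, j) = g (i, j))"
proof
  assume "mat n n f = mat n n g"
  then have "mat n n f $$ (i, j) = mat n n g $$ (i, j)" for i j by simp
  then show "\<forall>i<n. \<forall>j<n. f (i, j) = g (i, j)" by (metis index_mat(1))
qed auto

lemma bij_betw_mat_zmod:
  "bij_betw (mat n n) (({..<n} \<times> {..<n}) \<rightarrow>\<^sub>E {0..<int m}) (mat_zmod n m)"
proof (rule bij_betw_imageI)
  show "inj_on (mat n n) (({..<n} \<times> {..<n}) \<rightarrow>\<^sub>E {0..<int m})"
  proof (rule inj_onI)
    fix f g :: "nat \<times> nat \<Rightarrow> int"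
    assume "f \<in> ({..<n} \<times> {..<n}) \<rightarrow>\<^sub>E {0..<int m}" "g \<in> ({..<n} \<times> {..<n}) \<rightarrow>\<^sub>E {0..<int m}"
      and "mat n n f = mat n n g"
    then show "f = g" by (intro PiE_ext[of f _ _ g]) (auto simp: mat_eq_iff_index)
  qed
  show "mat n n ` (({..<n} \<times> {..<n}) \<rightarrow>\<^sub>E {0..<int m}) = mat_zmod n m"
  proof
    show "mat n n ` (({..<n} \<times> {..<n}) \<rightarrow>\<^sub>E {0..<int m}) \<subseteq> mat_zmod n m"
    proof (rule image_subsetI)
      fix g :: "nat \<times> nat \<Rightarrow> int"
      assume g: "g \<in> ({..<n} \<times> {..<n}) \<rightarrow>\<^sub>E {0..<int m}"
      have "g (i, j) \<in> {0..<int m}" if "i < n" "j < n" for i j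
        using PiE_mem[OF g, of "(i, j)"] that by blast
      then show "mat n n g \<in> mat_zmod n m" unfolding mat_zmod_def by simp
    qed
    show "mat_zmod n m \<subseteq> mat n n ` (({..<n} \<times> {..<n}) \<rightarrow>\<^sub>E {0..<int m})"
    proof
      fix A assume A: "A \<in> mat_zmod n m"
      let ?g = "restrict (($$) A) ({..<n} \<times> {..<n})"
      have "A = mat n n ?g" by (rule eq_matI) (use mat_zmodD[OF A] in auto)
      moreover have "?g \<in> ({..<n} \<times> {..<n}) \<rightarrow>\<^sub>E {0..<int m}"
        using A by (auto simp: mat_zmod_def)
      ultimately show "A \<in> mat n n ` (({..<n} \<times> {..<n}) \<rightarrow>\<^sub>E {0..<int m})" by blast
    qed
  qed
qed

lemma finite_mat_zmod: "finite (mat_zmod n m)"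
  using bij_betw_finite[OF bij_betw_mat_zmod[of n m]] by (simp add: finite_PiE)

lemma card_mat_zmod: "card (mat_zmod n m) = m ^ (n * n)"
  using bij_betw_same_card[OF bij_betw_mat_zmod[of n m]]
  by (simp add: card_PiE card_cartesian_product)

text \<open>The adjugate, scaled by an inverse of the determinant modulo \<open>m\<close>, is a
  two-sided inverse.\<close>

lemma Units_zmod_mats_if_coprime_det:
  assumes m: "m > 0" and A: "A \<in> mat_zmod n m" and det: "coprime (det A) (int m)"
  shows "A \<in> Units (zmod_mats n m)"
proof -
  have A': "A \<in> carrier_mat n n" by (rule mat_zmodD[OF A])
  note adj = adj_mat[OF A']
  obtain u where u: "[det A * u = 1] (mod int m)"
    using cong_solve_coprime_int[OF det] by blast
  let ?B = "u \<cdot>\<^sub>m adj_mat A"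
  have B: "?B \<in> carrier_mat n n" using adj(1) by simp
  have one: "reduce_mat m ((u * det A) \<cdot>\<^sub>m 1\<^sub>m n) = reduce_mat m (1\<^sub>m n)"
    by (rule eq_matI) (use u in \<open>auto simp: reduce_mat_def cong_def mult.commute\<close>)
  have "A * ?B = (u * det A) \<cdot>\<^sub>m 1\<^sub>m n" "?B * A = (u * det A) \<cdot>\<^sub>m 1\<^sub>m n"
    using adj mult_smult_distrib[OF A' adj(1)] mult_smult_assoc_mat[OF adj(1) A']
    by auto
  then have "mult_zmod m A (reduce_mat m ?B) = reduce_mat m (1\<^sub>m n)"
    "mult_zmod m (reduce_mat m ?B) A = reduce_mat m (1\<^sub>m n)"
    using one mult_zmod_reduce_left[OF B A'] mult_zmod_reduce_right[OF A' B]
    by (metis mult_zmod_def)+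
  then show ?thesis using A reduce_mat_in[OF m B] by (auto simp: Units_def)
qed

text \<open>Matrices whose determinant is prime to \<open>p\<close> are invertible, and the others
  are rare by \<open>card_det_dvd_le\<close>. The hypothesis \<open>cop\<close> is the only trace of
  \<open>p * q\<close> being a power of \<open>p\<close>; the additive form avoids truncated
  subtraction.\<close>

lemma card_Units_zmod_mats_ge:
  fixes p q :: nat
  assumes p: "prime p" and q: "q > 0" and cop: "\<And>x. \<not> int p dvd x \<Longrightarrow> coprime x (int (p * q))"
  shows "p * (p * q) ^ (n * n) \<le> p * card (Units (zmod_mats n (p * q))) + n * (p * q) ^ (n * n)"
proof -
  let ?W = "({..<n} \<times> {..<n}) \<rightarrow>\<^sub>E {0..<int (p * q)}" and ?U = "Units (zmod_mats n (p * q))"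
  let ?B = "{g \<in> ?W. int p dvd det (mat n n g)}"
  have m: "p * q > 0" using p q by (simp add: prime_gt_0_nat)
  have finW: "finite ?W" by (simp add: finite_PiE)
  have Ufin: "finite ?U"
    by (rule finite_subset[OF _ finite_mat_zmod[of n "p * q"]]) (auto simp: Units_def)
  have "mat n n ` (?W - ?B) \<subseteq> ?U"
  proof (rule image_subsetI)
    fix g assume g: "g \<in> ?W - ?B"
    then have "mat n n g \<in> mat_zmod n (p * q)" using bij_betw_mat_zmod[of n "p * q"] bij_betwE by blast
    then show "mat n n g \<in> ?U" using g m cop by (intro Units_zmod_mats_if_coprime_det) auto
  qed
  then have "card (mat n n ` (?W - ?B)) \<le> card ?U" by (rule card_mono[OF Ufin])
  moreover have "card (mat n n ` (?W - ?B)) = card (?W - ?B)"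
    using bij_betw_mat_zmod[of n "p * q"] by (intro card_image) (auto simp: bij_betw_def intro: inj_on_subset)
  ultimately have "card (?W - ?B) \<le> card ?U" by simp
  moreover have "card ?W = card (?W - ?B) + card ?B"
  proof -
    have B: "?B \<subseteq> ?W" by blast
    show ?thesis
      using card_Diff_subset[OF finite_subset[OF B finW] B] card_mono[OF finW B] by linarith
  qed
  ultimately have "p * card ?W \<le> p * card ?U + p * card ?B"
    by (simp flip: distrib_left)
  also have "\<dots> \<le> p * card ?U + n * (p * q) ^ (n * n)"
    by (rule add_left_mono[OF card_det_dvd_le[OF p]])
  also have "card ?W = (p * q) ^ (n * n)"
    by (simp add: card_PiE card_cartesian_product nat_mult_distrib)
  finally show ?thesis .
qed

section \<open>Diagonal matrices and conjugation\<close>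

lemma finite_Units_zmod_mats: "finite (Units (zmod_mats n m))"
  by (rule finite_subset[OF _ finite_mat_zmod[of n m]]) (auto simp: Units_def)

lemma mat_diag_in:
  assumes "m > 0" "d \<in> {..<n} \<rightarrow>\<^sub>E {0..<int m}"
  shows "mat_diag n d \<in> mat_zmod n m"
proof -
  have "d i \<in> {0..<int m}" if "i < n" for i using PiE_mem[OF assms(2), of i] that by simp
  then show ?thesis using assms(1) by (auto simp: mat_zmod_def mat_diag_def)
qed

lemma inj_on_mat_diag: "inj_on (mat_diag n) ({..<n} \<rightarrow>\<^sub>E V)"
proof (rule inj_onI)
  fix f g :: "nat \<Rightarrow> 'a"
  assume fg: "f \<in> {..<n} \<rightarrow>\<^sub>E V" "g \<in> {..<n} \<rightarrow>\<^sub>E V" and eq: "mat_diag n f = mat_diag n g"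
  have "f i = g i" if "i < n" for i
    using arg_cong[OF eq, of "\<lambda>A. A $$ (i, i)"] that by (simp add: mat_diag_def)
  then show "f = g" using fg by (intro PiE_ext[of f _ _ g]) auto
qed

lemma diagonal_mat_zmod:
  assumes D: "D \<in> mat_zmod n m" and "diagonal_mat D"
  obtains d where "d \<in> {..<n} \<rightarrow>\<^sub>E {0..<int m}" "D = mat_diag n d"
proof
  let ?d = "restrict (\<lambda>i. D $$ (i, i)) {..<n}"
  show "?d \<in> {..<n} \<rightarrow>\<^sub>E {0..<int m}" using D by (auto simp: mat_zmod_def)
  show "D = mat_diag n ?d"
    by (rule eq_matI) (use assms mat_zmodD[OF D] in \<open>auto simp: mat_diag_def diagonal_mat_def\<close>)
qed

lemma diagonal_mat_mat_diag: "diagonal_mat (mat_diag n d)"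
  by (auto simp: diagonal_mat_def mat_diag_def)

lemma mult_zmod_mat_diag_index:
  assumes "A \<in> carrier_mat n n" "i < n" "j < n"
  shows "mult_zmod m A (mat_diag n d) $$ (i, j) = (A $$ (i, j) * d j) mod int m"
    and "mult_zmod m (mat_diag n d) A $$ (i, j) = (d i * A $$ (i, j)) mod int m"
  using assms
  by (simp_all add: mult_zmod_def reduce_mat_def mat_diag_mult_left[OF assms(1)] mat_diag_mult_right[OF assms(1)])

lemma mult_zmod_mat_diag_commute:
  "mult_zmod m (mat_diag n d) (mat_diag n t) = mult_zmod m (mat_diag n t) (mat_diag n d)"
  by (simp add: mult_zmod_def mult.commute)

text \<open>The diagonal matrices with unit entries, a copy of the \<open>n\<close>-fold product of
  the unit group modulo \<open>m\<close>.\<close>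

definition torus :: "nat \<Rightarrow> nat \<Rightarrow> int mat set" where
  "torus n m = mat_diag n ` ({..<n} \<rightarrow>\<^sub>E {x \<in> {0..<int m}. coprime x (int m)})"

lemma torus_subset_Units:
  assumes m: "m > 0"
  shows "torus n m \<subseteq> Units (zmod_mats n m)"
  unfolding torus_def
proof (rule image_subsetI)
  fix d assume d: "d \<in> {..<n} \<rightarrow>\<^sub>E {x \<in> {0..<int m}. coprime x (int m)}"
  have mem: "d i \<in> {0..<int m}" "coprime (d i) (int m)" if "i < n" for i
    using PiE_mem[OF d, of i] that by auto
  have "det (mat_diag n d) = prod_list (diag_mat (mat_diag n d))"
    by (rule det_upper_triangular[of _ n]) (auto simp: mat_diag_def)
  also have "\<dots> = (\<Prod>i<n. d i)"
    by (simp add: prod_list_diag_prod) (simp add: mat_diag_def atLeast0LessThan)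
  also have "coprime \<dots> (int m)" using mem by (intro prod_coprime_left) auto
  finally have "coprime (det (mat_diag n d)) (int m)" .
  moreover have "d \<in> {..<n} \<rightarrow>\<^sub>E {0..<int m}" using d by (auto simp: PiE_def)
  ultimately show "mat_diag n d \<in> Units (zmod_mats n m)"
    using m mat_diag_in by (intro Units_zmod_mats_if_coprime_det)
qed

lemma card_torus: "card (torus n m) = card {x \<in> {0..<int m}. coprime x (int m)} ^ n"
  unfolding torus_def by (simp add: card_image[OF inj_on_mat_diag] card_PiE)

section \<open>Conjugates of diagonal matrices\<close>

definition diag_conj :: "nat \<Rightarrow> nat \<Rightarrow> int mat \<Rightarrow> (nat \<Rightarrow> int) \<Rightarrow> int mat" where
  "diag_conj n m P d = mult_zmod m (mult_zmod m P (mat_diag n d)) (inv\<^bsub>zmod_mats n m\<^esub> P)"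

text \<open>Multiplying by \<open>P\<close> on the right clears the inverse. The resulting relation
  says that the columns of \<open>P\<close> are eigenvectors of \<open>A\<close>, and later
  arguments use it in this form.\<close>

lemma diag_conj_eq_iff:
  assumes m: "m > 0" and P: "P \<in> Units (zmod_mats n m)"
    and d: "d \<in> {..<n} \<rightarrow>\<^sub>E {0..<int m}" and A: "A \<in> mat_zmod n m"
  shows "diag_conj n m P d = A \<longleftrightarrow> mult_zmod m P (mat_diag n d) = mult_zmod m A P"
proof -
  let ?G = "zmod_mats n m"
  interpret monoid ?G by (rule monoid_zmod_mats[OF m])
  define D where "D = mat_diag n d"
  have c: "D \<in> carrier ?G" "P \<in> carrier ?G" "A \<in> carrier ?G" "inv\<^bsub>?G\<^esub> P \<in> carrier ?G"
    using mat_diag_in[OF m d] A Units_closed[OF P] Units_inv_closed[OF P] by (simp_all add: D_def)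
  have "mult ?G (mult ?G P D) (inv\<^bsub>?G\<^esub> P) = A \<longleftrightarrow> mult ?G P D = mult ?G A P"
  proof
    assume "mult ?G (mult ?G P D) (inv\<^bsub>?G\<^esub> P) = A"
    then have "mult ?G A P = mult ?G (mult ?G (mult ?G P D) (inv\<^bsub>?G\<^esub> P)) P" by simp
    also have "\<dots> = mult ?G P D" using c P by (simp only: m_assoc m_closed Units_l_inv r_one)
    finally show "mult ?G P D = mult ?G A P" by simp
  next
    assume "mult ?G P D = mult ?G A P"
    then have "mult ?G (mult ?G P D) (inv\<^bsub>?G\<^esub> P) = mult ?G (mult ?G A P) (inv\<^bsub>?G\<^esub> P)" by simp
    also have "\<dots> = A" using c P by (simp only: m_assoc m_closed Units_r_inv r_one)
    finally show "mult ?G (mult ?G P D) (inv\<^bsub>?G\<^esub> P) = A" .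
  qed
  then show ?thesis by (simp add: diag_conj_def D_def)
qed

lemma diag_conj_in:
  assumes m: "m > 0" and P: "P \<in> Units (zmod_mats n m)" and d: "d \<in> {..<n} \<rightarrow>\<^sub>E {0..<int m}"
  shows "diag_conj n m P d \<in> mat_zmod n m"
proof -
  interpret monoid "zmod_mats n m" by (rule monoid_zmod_mats[OF m])
  show ?thesis
    using mat_diag_in[OF m d] Units_closed[OF P] Units_inv_closed[OF P] m
    by (simp add: diag_conj_def mult_zmod_in)
qed

lemma Diag_zmod_eq:
  assumes m: "m > 0"
  shows "Diag_zmod n m =
    (\<lambda>(P, d). diag_conj n m P d) ` (Units (zmod_mats n m) \<times> ({..<n} \<rightarrow>\<^sub>E {0..<int m}))"
proof (intro equalityI subsetI)
  fix A assume "A \<in> Diag_zmod n m"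
  then obtain P Q D where "inverse_zmod n m P Q" "D \<in> mat_zmod n m" "diagonal_mat D"
    and A: "A = mult_zmod m (mult_zmod m P D) Q"
    by (auto simp: Diag_zmod_def diagonalizable_zmod_def)
  then obtain d where "d \<in> {..<n} \<rightarrow>\<^sub>E {0..<int m}" "D = mat_diag n d"
    and "P \<in> Units (zmod_mats n m)" "Q = inv\<^bsub>zmod_mats n m\<^esub> P"
    using diagonal_mat_zmod inverse_zmod_iff[OF m] by metis
  then show "A \<in> (\<lambda>(P, d). diag_conj n m P d) ` (Units (zmod_mats n m) \<times> ({..<n} \<rightarrow>\<^sub>E {0..<int m}))"
    using A by (auto simp: diag_conj_def)
next
  fix A assume "A \<in> (\<lambda>(P, d). diag_conj n m P d) ` (Units (zmod_mats n m) \<times> ({..<n} \<rightarrow>\<^sub>E {0..<int m}))"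
  then obtain P d where P: "P \<in> Units (zmod_mats n m)" and d: "d \<in> {..<n} \<rightarrow>\<^sub>E {0..<int m}"
    and A: "A = diag_conj n m P d" by auto
  have "diagonalizable_zmod n m A"
    unfolding diagonalizable_zmod_def
    using P A inverse_zmod_iff[OF m] mat_diag_in[OF m d] diagonal_mat_mat_diag diag_conj_def by metis
  then show "A \<in> Diag_zmod n m" using diag_conj_in[OF m P d] A by (simp add: Diag_zmod_def)
qed

lemma finite_Diag_zmod: "finite (Diag_zmod n m)"
  by (rule finite_subset[OF _ finite_mat_zmod[of n m]]) (auto simp: Diag_zmod_def)

text \<open>Rescaling eigenvectors by units: \<open>t\<close> commutes with the diagonal matrix, so
  \<open>P t D = P D t = A P t\<close>.\<close>

lemma diag_conj_torus:
  assumes m: "m > 0" and P: "P \<in> Units (zmod_mats n m)" and d: "d \<in> {..<n} \<rightarrow>\<^sub>E {0..<int m}"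
    and t: "t \<in> torus n m"
  shows "diag_conj n m (mult_zmod m P t) d = diag_conj n m P d"
proof -
  let ?G = "zmod_mats n m" and ?A = "diag_conj n m P d"
  interpret monoid ?G by (rule monoid_zmod_mats[OF m])
  define D where "D = mat_diag n d"
  have A: "?A \<in> carrier ?G" using diag_conj_in[OF m P d] by simp
  have tU: "t \<in> Units ?G" using torus_subset_Units[OF m] t by blast
  have c: "D \<in> carrier ?G" "P \<in> carrier ?G" "t \<in> carrier ?G"
    using mat_diag_in[OF m d] Units_closed[OF P] Units_closed[OF tU] by (simp_all add: D_def)
  have PD: "mult ?G P D = mult ?G ?A P"
    using diag_conj_eq_iff[OF m P d, of ?A] A by (simp add: D_def)
  have tD: "mult ?G t D = mult ?G D t"
    using t mult_zmod_mat_diag_commute by (auto simp: torus_def D_def)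
  have "mult ?G (mult ?G P t) D = mult ?G (mult ?G P D) t"
    using c by (simp only: m_assoc tD)
  also have "\<dots> = mult ?G ?A (mult ?G P t)" using A c by (simp only: PD m_assoc)
  finally show ?thesis
    using diag_conj_eq_iff[OF m Units_m_closed[OF P tU] d, of ?A] A by (simp add: D_def)
qed

text \<open>Reordering the eigenvectors, that is the columns of \<open>P\<close>, reorders the
  eigenvalues in the same way.\<close>

lemma diag_conj_permute:
  assumes m: "m > 0" and P: "P \<in> Units (zmod_mats n m)" and d: "d \<in> {..<n} \<rightarrow>\<^sub>E {0..<int m}"
    and e: "e \<in> {..<n} \<rightarrow>\<^sub>E {0..<int m}"
    and \<sigma>: "bij_betw \<sigma> {..<n} {..<n}" and ed: "\<And>i. i < n \<Longrightarrow> e i = d (\<sigma> i)"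
  shows "\<exists>P' \<in> Units (zmod_mats n m). diag_conj n m P' e = diag_conj n m P d"
proof -
  let ?G = "zmod_mats n m" and ?A = "diag_conj n m P d"
  interpret monoid ?G by (rule monoid_zmod_mats[OF m])
  define Q where "Q = inv\<^bsub>?G\<^esub> P"
  define P' where "P' = mat n n (\<lambda>(i, j). P $$ (i, \<sigma> j))"
  \<comment> \<open>Permuting the columns of \<open>P\<close> is undone by permuting the rows of its
    inverse.\<close>
  define Q' where "Q' = mat n n (\<lambda>(i, j). Q $$ (\<sigma> i, j))"
  have A: "?A \<in> mat_zmod n m" by (rule diag_conj_in[OF m P d])
  have PQ: "P \<in> mat_zmod n m" "Q \<in> mat_zmod n m"
    "mult_zmod m P Q = reduce_mat m (1\<^sub>m n)" "mult_zmod m Q P = reduce_mat m (1\<^sub>m n)"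
    using Units_closed[OF P] Units_inv_closed[OF P] Units_l_inv[OF P] Units_r_inv[OF P]
    by (simp_all add: Q_def)
  note cm = mat_zmodD[OF A] mat_zmodD[OF PQ(1)] mat_zmodD[OF PQ(2)]
  have \<sigma>n: "\<sigma> i < n" if "i < n" for i using \<sigma> that by (auto simp: bij_betw_def)
  have \<sigma>inj: "\<sigma> i = \<sigma> j \<longleftrightarrow> i = j" if "i < n" "j < n" for i j
    using \<sigma> that by (auto simp: bij_betw_def inj_on_def)
  have P': "P' \<in> mat_zmod n m" and Q': "Q' \<in> mat_zmod n m"
    using PQ \<sigma>n by (auto simp: mat_zmod_def P'_def Q'_def)
  note cm' = mat_zmodD[OF P'] mat_zmodD[OF Q']
  have one: "reduce_mat m (1\<^sub>m n) $$ (i, j) = (if i = j then 1 else 0) mod int m"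
    if "i < n" "j < n" for i j using that by (simp add: reduce_mat_def)
  have P'Q': "mult_zmod m P' Q' = reduce_mat m (1\<^sub>m n)"
  proof (rule eq_matI)
    fix i j assume "i < dim_row (reduce_mat m (1\<^sub>m n))" "j < dim_col (reduce_mat m (1\<^sub>m n))"
    then have ij: "i < n" "j < n" by (auto simp: reduce_mat_def)
    have "(\<Sum>k<n. P' $$ (i, k) * Q' $$ (k, j)) = (\<Sum>k<n. P $$ (i, \<sigma> k) * Q $$ (\<sigma> k, j))"
      using ij by (simp add: P'_def Q'_def)
    also have "\<dots> = (\<Sum>k<n. P $$ (i, k) * Q $$ (k, j))"
      by (rule sum.reindex_bij_betw[OF \<sigma>])
    finally show "mult_zmod m P' Q' $$ (i, j) = reduce_mat m (1\<^sub>m n) $$ (i, j)"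
      using mult_zmod_index[OF cm' ij, of m] mult_zmod_index[OF cm(2,3) ij, of m] PQ(3) by simp
  qed (auto simp: mult_zmod_def reduce_mat_def P'_def Q'_def)
  have Q'P': "mult_zmod m Q' P' = reduce_mat m (1\<^sub>m n)"
  proof (rule eq_matI)
    fix i j assume "i < dim_row (reduce_mat m (1\<^sub>m n))" "j < dim_col (reduce_mat m (1\<^sub>m n))"
    then have ij: "i < n" "j < n" by (auto simp: reduce_mat_def)
    \<comment> \<open>In this order the permutation acts on the outer indices, so injectivity of
      \<open>\<sigma>\<close> preserves the identity matrix; in the other order it acts on the
      summation index.\<close>
    have "(\<Sum>k<n. Q' $$ (i, k) * P' $$ (k, j)) = (\<Sum>k<n. Q $$ (\<sigma> i, k) * P $$ (k, \<sigma> j))"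
      using ij by (simp add: P'_def Q'_def)
    then have "mult_zmod m Q' P' $$ (i, j) = mult_zmod m Q P $$ (\<sigma> i, \<sigma> j)"
      using mult_zmod_index[OF cm'(2,1) ij, of m]
        mult_zmod_index[OF cm(3,2) \<sigma>n[OF ij(1)] \<sigma>n[OF ij(2)], of m] by simp
    then show "mult_zmod m Q' P' $$ (i, j) = reduce_mat m (1\<^sub>m n) $$ (i, j)"
      using PQ(4) one ij \<sigma>n \<sigma>inj by simp
  qed (auto simp: mult_zmod_def reduce_mat_def P'_def Q'_def)
  have P'U: "P' \<in> Units ?G" using P' Q' P'Q' Q'P' by (auto simp: Units_def)
  have AP: "mult_zmod m P (mat_diag n d) = mult_zmod m ?A P"
    using diag_conj_eq_iff[OF m P d A] by simp
  have "mult_zmod m P' (mat_diag n e) = mult_zmod m ?A P'"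
  proof (rule eq_matI)
    fix i j assume "i < dim_row (mult_zmod m ?A P')" "j < dim_col (mult_zmod m ?A P')"
    then have ij: "i < n" "j < n" using cm by (auto simp: mult_zmod_def reduce_mat_def P'_def)
    have "mult_zmod m P' (mat_diag n e) $$ (i, j) = (P' $$ (i, j) * e j) mod int m"
      by (rule mult_zmod_mat_diag_index[OF cm'(1) ij])
    also have "\<dots> = (P $$ (i, \<sigma> j) * d (\<sigma> j)) mod int m" using ij ed by (simp add: P'_def)
    also have "\<dots> = mult_zmod m P (mat_diag n d) $$ (i, \<sigma> j)"
      by (rule mult_zmod_mat_diag_index[OF cm(2) ij(1) \<sigma>n[OF ij(2)], symmetric])
    also have "\<dots> = (\<Sum>k<n. ?A $$ (i, k) * P $$ (k, \<sigma> j)) mod int m"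
      unfolding AP by (rule mult_zmod_index[OF cm(1,2) ij(1) \<sigma>n[OF ij(2)]])
    also have "\<dots> = mult_zmod m ?A P' $$ (i, j)"
      using ij by (simp add: mult_zmod_index[OF cm(1) cm'(1) ij]) (simp add: P'_def)
    finally show "mult_zmod m P' (mat_diag n e) $$ (i, j) = mult_zmod m ?A P' $$ (i, j)" .
  qed (use cm in \<open>auto simp: mult_zmod_def reduce_mat_def P'_def mat_diag_def\<close>)
  then have "diag_conj n m P' e = ?A" using diag_conj_eq_iff[OF m P'U e A] by simp
  then show ?thesis using P'U by blast
qed

section \<open>Counting diagonalizable matrices\<close>

text \<open>The increasing enumeration of \<open>E\<close>, restricted so that it belongs to the
  function space in which tuples of eigenvalues are counted.\<close>

definition enum :: "nat \<Rightarrow> int set \<Rightarrow> nat \<Rightarrow> int" where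
  "enum n E = restrict ((!) (sorted_list_of_set E)) {..<n}"

text \<open>The possible sets of \<open>n\<close> distinct eigenvalues. Passing from tuples to sets
  removes the \<open>n!\<close> orderings and so produces the limit \<open>1 / n!\<close>.\<close>

definition spectra :: "nat \<Rightarrow> nat \<Rightarrow> int set set" where
  "spectra n m = {E. E \<subseteq> {0..<int m} \<and> card E = n}"

lemma finite_spectra: "finite (spectra n m)"
  by (simp add: spectra_def)

lemma card_spectra: "card (spectra n m) = m choose n"
  using n_subsets[of "{0..<int m}" n] by (simp add: spectra_def)

lemma bij_betw_enum:
  assumes "E \<in> spectra n m"
  shows "bij_betw (enum n E) {..<n} E"
proof -
  have E: "finite E" "card E = n" using assms by (auto simp: spectra_def intro: finite_subset)
  have "bij_betw ((!) (sorted_list_of_set E)) {..<n} E"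
    by (rule bij_betw_nth) (use E in auto)
  then show ?thesis by (rule bij_betw_cong[THEN iffD1, rotated]) (simp add: enum_def)
qed

lemma enum_in:
  assumes "E \<in> spectra n m"
  shows "enum n E \<in> {..<n} \<rightarrow>\<^sub>E {0..<int m}"
proof -
  have "enum n E i \<in> {0..<int m}" if "i < n" for i
    using bij_betwE[OF bij_betw_enum[OF assms]] assms that by (auto simp: spectra_def)
  then show ?thesis by (auto simp: enum_def)
qed

lemma inj_on_enum: "inj_on (enum n) (spectra n m)"
  by (rule inj_onI) (metis bij_betw_imp_surj_on bij_betw_enum)

text \<open>Sorting: the permutation sends a position in increasing order to the position of the
  same eigenvalue in \<open>d\<close>.\<close>

lemma diag_conj_enum:
  assumes m: "m > 0" and P: "P \<in> Units (zmod_mats n m)" and d: "d \<in> {..<n} \<rightarrow>\<^sub>E {0..<int m}"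
    and inj: "inj_on d {..<n}"
  shows "\<exists>P' \<in> Units (zmod_mats n m). \<exists>E \<in> spectra n m. diag_conj n m P' (enum n E) = diag_conj n m P d"
proof -
  let ?E = "d ` {..<n}"
  have E: "?E \<in> spectra n m" using d by (auto simp: spectra_def card_image[OF inj])
  have bd: "bij_betw d {..<n} ?E" using inj by (simp add: bij_betw_def)
  let ?\<sigma> = "inv_into {..<n} d \<circ> enum n ?E"
  have "bij_betw ?\<sigma> {..<n} {..<n}"
    by (rule bij_betw_trans[OF bij_betw_enum[OF E] bij_betw_inv_into[OF bd]])
  moreover have "enum n ?E i = d (?\<sigma> i)" if "i < n" for i
  proof -
    have "enum n ?E i \<in> ?E" using bij_betwE[OF bij_betw_enum[OF E]] that by blast
    then show ?thesis by (simp add: f_inv_into_f)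
  qed
  ultimately show ?thesis using diag_conj_permute[OF m P d enum_in[OF E]] E by blast
qed

text \<open>Eigenvalue tuples with distinct entries can be sorted, and the others are collisions.
  Over the remaining pairs each fibre contains a free torus orbit, of size
  \<open>u ^ n\<close>.\<close>

lemma Diag_zmod_upper:
  assumes m: "m > 0" and p: "p > 0"
  defines "u \<equiv> card {x \<in> {0..<int m}. coprime x (int m)}"
  shows "u ^ n * card (Diag_zmod n m) \<le> m ^ (n * n) * ((m choose n) + card (residue_collisions p m n))"
proof -
  let ?G = "zmod_mats n m" and ?f = "\<lambda>(P, d). diag_conj n m P d"
  \<comment> \<open>The two parts may overlap, which is harmless for an upper bound.\<close>
  let ?S = "enum n ` spectra n m \<union> residue_collisions p m n"
  interpret monoid ?G by (rule monoid_zmod_mats[OF m])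
  have S: "?S \<subseteq> {..<n} \<rightarrow>\<^sub>E {0..<int m}"
    using enum_in by (auto simp: residue_collisions_def)
  have finS: "finite ?S" by (simp add: finite_spectra finite_residue_collisions)
  have "Diag_zmod n m \<subseteq> ?f ` (Units ?G \<times> ?S)"
  proof
    fix A assume "A \<in> Diag_zmod n m"
    then obtain P d where P: "P \<in> Units ?G" and d: "d \<in> {..<n} \<rightarrow>\<^sub>E {0..<int m}"
      and A: "A = diag_conj n m P d" unfolding Diag_zmod_eq[OF m] by auto
    have "\<exists>P' \<in> Units ?G. \<exists>d' \<in> ?S. diag_conj n m P' d' = A"
    proof (cases "inj_on d {..<n}")
      case True
      then show ?thesis using diag_conj_enum[OF m P d] A by blast
    next
      case False
      then obtain i j where ij: "i < n" "j < n" "i \<noteq> j" "d i = d j" by (auto simp: inj_on_def)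
      then have "int p dvd d i - d j" by simp
      then have "d \<in> residue_collisions p m n" using d ij unfolding residue_collisions_def by blast
      then show ?thesis using P A by blast
    qed
    then show "A \<in> ?f ` (Units ?G \<times> ?S)" by force
  qed
  then have "card (Diag_zmod n m) \<le> card (?f ` (Units ?G \<times> ?S))"
    using finS finite_Units_zmod_mats by (intro card_mono) auto
  then have "u ^ n * card (Diag_zmod n m) \<le> u ^ n * card (?f ` (Units ?G \<times> ?S))"
    by (rule mult_le_mono2)
  also have "\<dots> \<le> card (Units ?G \<times> ?S)"
  proof (rule fibre_card_mult_image_le)
    show fin: "finite (Units ?G \<times> ?S)" using finS finite_Units_zmod_mats by blast
    fix x assume x: "x \<in> Units ?G \<times> ?S"
    obtain P d where Pd: "x = (P, d)" "P \<in> Units ?G" "d \<in> ?S" using x by auto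
    then have d: "d \<in> {..<n} \<rightarrow>\<^sub>E {0..<int m}" using S by blast
    let ?g = "\<lambda>t. (mult_zmod m P t, d)"
    have tU: "t \<in> Units ?G" if "t \<in> torus n m" for t using torus_subset_Units[OF m] that by blast
    have "inj_on ?g (torus n m)"
    proof (rule inj_onI)
      fix s t assume "s \<in> torus n m" "t \<in> torus n m" "?g s = ?g t"
      then show "s = t"
        using Units_l_cancel[OF Pd(2) Units_closed[OF tU] Units_closed[OF tU], of s t] by simp
    qed
    moreover have "?g ` torus n m \<subseteq> {y \<in> Units ?G \<times> ?S. ?f y = ?f x}"
      using Pd tU diag_conj_torus[OF m Pd(2) d] Units_m_closed[OF Pd(2)] by auto
    ultimately have "card (torus n m) \<le> card {y \<in> Units ?G \<times> ?S. ?f y = ?f x}"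
      using fin by (intro card_inj_on_le) auto
    then show "u ^ n \<le> card {y \<in> Units ?G \<times> ?S. ?f y = ?f x}" by (simp add: card_torus u_def)
  qed
  also have "\<dots> = card (Units ?G) * card ?S" by (rule card_cartesian_product)
  also have "\<dots> \<le> m ^ (n * n) * ((m choose n) + card (residue_collisions p m n))"
  proof (rule mult_le_mono)
    show "card (Units ?G) \<le> m ^ (n * n)"
      unfolding card_mat_zmod[symmetric] by (rule card_mono[OF finite_mat_zmod]) (auto simp: Units_def)
    have "card ?S \<le> card (enum n ` spectra n m) + card (residue_collisions p m n)" by (rule card_Un_le)
    also have "card (enum n ` spectra n m) = m choose n"
      by (simp add: card_image[OF inj_on_enum] card_spectra)
    finally show "card ?S \<le> (m choose n) + card (residue_collisions p m n)" .
  qed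
  finally show ?thesis .
qed

section \<open>Intertwiners of diagonal matrices and the lower bound\<close>

lemma dvd_diff_imp_eq:
  fixes x y :: int
  assumes "x \<in> {0..<m}" "y \<in> {0..<m}" "m dvd x - y"
  shows "x = y"
  using assms by (metis atLeastLessThan_iff mod_eq_dvd_iff mod_pos_pos_trivial)

text \<open>Comparing entries in \<open>C D = D' C\<close> gives \<open>c\<^sub>i\<^sub>j (d\<^sub>j - d'\<^sub>i) = 0\<close>, and every column of the
  invertible matrix \<open>C\<close> contains an entry that is not divisible by \<open>p\<close>.\<close>

lemma intertwiner_column:
  assumes m: "m > 0" and p: "prime p" "p dvd m" and C: "C \<in> Units (zmod_mats n m)"
    and cop: "\<And>x. \<not> int p dvd x \<Longrightarrow> coprime x (int m)"
    and d: "d \<in> {..<n} \<rightarrow>\<^sub>E {0..<int m}" "d' \<in> {..<n} \<rightarrow>\<^sub>E {0..<int m}"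
    and CD: "mult_zmod m C (mat_diag n d) = mult_zmod m (mat_diag n d') C"
    and j: "j < n"
  shows "\<exists>i<n. coprime (C $$ (i, j)) (int m) \<and> d j = d' i"
    and "i < n \<Longrightarrow> int m dvd C $$ (i, j) * (d j - d' i)"
proof -
  let ?G = "zmod_mats n m"
  interpret monoid ?G by (rule monoid_zmod_mats[OF m])
  have C': "C \<in> carrier_mat n n" using Units_closed[OF C] by (auto dest: mat_zmodD)
  show dv: "int m dvd C $$ (i, j) * (d j - d' i)" if i: "i < n" for i
    using mult_zmod_mat_diag_index[OF C' i j, of m] CD
    by (metis mod_eq_dvd_iff mult.commute right_diff_distrib)
  obtain Q where Q: "Q \<in> mat_zmod n m" "mult_zmod m Q C = reduce_mat m (1\<^sub>m n)"
    using C by (auto simp: Units_def)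
  have "\<exists>i<n. \<not> int p dvd C $$ (i, j)"
  proof (rule ccontr)
    assume "\<not> (\<exists>i<n. \<not> int p dvd C $$ (i, j))"
    \<comment> \<open>If \<open>p\<close> divided the whole column, it would divide the
      \<open>(j, j)\<close> entry of \<open>Q C\<close>, which is 1 modulo \<open>m\<close> and
      hence modulo \<open>p\<close>.\<close>
    then have "int p dvd (\<Sum>k<n. Q $$ (j, k) * C $$ (k, j))" by (intro dvd_sum) auto
    moreover have "(\<Sum>k<n. Q $$ (j, k) * C $$ (k, j)) mod int m = 1 mod int m"
      using mult_zmod_index[OF mat_zmodD[OF Q(1)] C' j j, of m] Q(2) j by (simp add: reduce_mat_def)
    then have "int m dvd (\<Sum>k<n. Q $$ (j, k) * C $$ (k, j)) - 1" by (simp add: mod_eq_dvd_iff)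
    then have "int p dvd (\<Sum>k<n. Q $$ (j, k) * C $$ (k, j)) - 1"
      using p(2) by (meson dvd_trans int_dvd_int_iff)
    ultimately have "int p dvd (\<Sum>k<n. Q $$ (j, k) * C $$ (k, j)) - ((\<Sum>k<n. Q $$ (j, k) * C $$ (k, j)) - 1)"
      by (rule dvd_diff)
    then have "int p dvd 1" by simp
    then show False using p(1) by simp
  qed
  then obtain i where i: "i < n" "\<not> int p dvd C $$ (i, j)" by blast
  have co: "coprime (C $$ (i, j)) (int m)" by (rule cop[OF i(2)])
  \<comment> \<open>A unit entry of \<open>C\<close> can be cancelled; least residues that are
    congruent modulo \<open>m\<close> are equal.\<close>
  then have "int m dvd d j - d' i"
    using dv[OF i(1)] by (simp add: coprime_commute coprime_dvd_mult_right_iff)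
  then have "d j = d' i"
    using PiE_mem[OF d(1), of j] PiE_mem[OF d(2), of i] i j by (intro dvd_diff_imp_eq[of _ "int m"]) auto
  then show "\<exists>i<n. coprime (C $$ (i, j)) (int m) \<and> d j = d' i" using i co by blast
qed

text \<open>The eigenvalue differences are units, which forces the off-diagonal entries to vanish.
  The unit entry present in each column must then be the diagonal one.\<close>

lemma intertwiner_in_torus:
  assumes m: "m > 0" and p: "prime p" "p dvd m" and C: "C \<in> Units (zmod_mats n m)"
    and cop: "\<And>x. \<not> int p dvd x \<Longrightarrow> coprime x (int m)"
    and d: "d \<in> {..<n} \<rightarrow>\<^sub>E {0..<int m}" "d \<notin> residue_collisions p m n"
    and CD: "mult_zmod m C (mat_diag n d) = mult_zmod m (mat_diag n d) C"
  shows "C \<in> torus n m"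
proof -
  interpret monoid "zmod_mats n m" by (rule monoid_zmod_mats[OF m])
  have C': "C \<in> mat_zmod n m" using Units_closed[OF C] by simp
  note column = intertwiner_column[OF m p C cop d(1) d(1) CD]
  have distinct: "i = j" if "i < n" "j < n" "int p dvd d i - d j" for i j
    using d that unfolding residue_collisions_def by blast
  have unit: "coprime (C $$ (j, j)) (int m)" if j: "j < n" for j
  proof -
    obtain i where i: "i < n" "coprime (C $$ (i, j)) (int m)" "d j = d i"
      using column(1)[OF _ j] by blast
    have "j = i" by (rule distinct[OF j i(1)]) (simp add: i(3))
    then show ?thesis using i(2) by simp
  qed
  have off: "C $$ (i, j) = 0" if ij: "i < n" "j < n" "i \<noteq> j" for i j
  proof -
    have "\<not> int p dvd d j - d i" using distinct[OF ij(2,1)] ij(3) by auto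
    then have "coprime (d j - d i) (int m)" by (rule cop)
    then have "int m dvd C $$ (i, j) - 0"
      using column(2)[OF _ ij(2,1)] by (simp add: coprime_commute coprime_dvd_mult_left_iff)
    then show ?thesis
      using C' ij m by (intro dvd_diff_imp_eq[of _ "int m"]) (auto simp: mat_zmod_def)
  qed
  have "diagonal_mat C" using off mat_zmodD[OF C'] by (auto simp: diagonal_mat_def)
  then obtain t where t: "t \<in> {..<n} \<rightarrow>\<^sub>E {0..<int m}" "C = mat_diag n t"
    using diagonal_mat_zmod[OF C'] by blast
  have "t i \<in> {x \<in> {0..<int m}. coprime x (int m)}" if "i < n" for i
    using PiE_mem[OF t(1), of i] unit[OF that] that by (simp add: t(2) mat_diag_def)
  then have "t \<in> {..<n} \<rightarrow>\<^sub>E {x \<in> {0..<int m}. coprime x (int m)}"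
    using t(1) by (auto simp: PiE_def)
  then show ?thesis using t(2) by (simp add: torus_def)
qed

text \<open>Only eigenvalue sets without collisions modulo \<open>p\<close> are used. Two pairs with
  the same conjugate share the set and differ by a torus element, so fibres are small.\<close>

lemma Diag_zmod_lower:
  assumes m: "m > 0" and p: "prime p" "p dvd m"
    and cop: "\<And>x. \<not> int p dvd x \<Longrightarrow> coprime x (int m)"
  shows "card (Units (zmod_mats n m)) * (m choose n) \<le>
    m ^ n * card (Diag_zmod n m) + card (Units (zmod_mats n m)) * card (residue_collisions p m n)"
proof -
  let ?G = "zmod_mats n m" and ?f = "\<lambda>(P, E). diag_conj n m P (enum n E)"
  let ?bad = "{E \<in> spectra n m. enum n E \<in> residue_collisions p m n}"
  let ?X = "Units ?G \<times> (spectra n m - ?bad)"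
  interpret monoid ?G by (rule monoid_zmod_mats[OF m])
  have fin: "finite ?X" using finite_Units_zmod_mats finite_spectra by blast
  have "card {y \<in> ?X. ?f y = ?f x} \<le> m ^ n" if x_in: "x \<in> ?X" for x
  proof -
    obtain P E where x: "x = (P, E)" and P: "P \<in> Units ?G" and E: "E \<in> spectra n m"
      and good: "enum n E \<notin> residue_collisions p m n" using x_in by auto
    note e = enum_in[OF E]
    let ?A = "diag_conj n m P (enum n E)"
    have A: "?A \<in> mat_zmod n m" by (rule diag_conj_in[OF m P e])
    have "{y \<in> ?X. ?f y = ?f x} \<subseteq> (\<lambda>t. (mult_zmod m P t, E)) ` torus n m"
    proof
      fix y assume "y \<in> {y \<in> ?X. ?f y = ?f x}"
      then obtain P' E' where y: "y = (P', E')" and P': "P' \<in> Units ?G" and E': "E' \<in> spectra n m"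
        and eq: "diag_conj n m P' (enum n E') = ?A" using x by auto
      note e' = enum_in[OF E']
      \<comment> \<open>The change of basis between two diagonalizations of the same matrix; it
        intertwines \<open>D'\<close> and \<open>D\<close>.\<close>
      define C where "C = mult ?G (inv\<^bsub>?G\<^esub> P) P'"
      define D where "D = mat_diag n (enum n E)"
      define D' where "D' = mat_diag n (enum n E')"
      define B where "B = ?A"
      have CU: "C \<in> Units ?G" unfolding C_def using P P' by blast
      have c: "P \<in> carrier ?G" "P' \<in> carrier ?G" "inv\<^bsub>?G\<^esub> P \<in> carrier ?G" "D \<in> carrier ?G"
        "D' \<in> carrier ?G" "B \<in> carrier ?G"
        using P P' A mat_diag_in[OF m e] mat_diag_in[OF m e'] Units_closed[OF P] Units_closed[OF P']
          Units_inv_closed[OF P] by (auto simp: D_def D'_def B_def)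
      have PD: "mult ?G P D = mult ?G B P" "mult ?G P' D' = mult ?G B P'"
        using diag_conj_eq_iff[OF m P e A] diag_conj_eq_iff[OF m P' e' A] eq
        by (simp_all add: D_def D'_def B_def)
      have PC: "mult ?G P C = P'"
        unfolding C_def using c P by (simp add: m_assoc[symmetric] del: zmod_mats_simps)
      have "mult ?G P (mult ?G C D') = mult ?G P' D'"
        using c Units_closed[OF CU] by (simp add: m_assoc[symmetric] PC del: zmod_mats_simps)
      also have "\<dots> = mult ?G B (mult ?G P C)" by (simp only: PC PD)
      also have "\<dots> = mult ?G (mult ?G P D) C"
        using c Units_closed[OF CU] by (simp add: m_assoc PD del: zmod_mats_simps)
      also have "\<dots> = mult ?G P (mult ?G D C)"
        using c Units_closed[OF CU] by (simp add: m_assoc del: zmod_mats_simps)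
      finally have "mult ?G C D' = mult ?G D C"
        using Units_l_cancel[OF P] c Units_closed[OF CU] by (simp del: zmod_mats_simps)
      then have CD: "mult_zmod m C (mat_diag n (enum n E')) = mult_zmod m (mat_diag n (enum n E)) C"
        by (simp add: D_def D'_def)
      \<comment> \<open>Each column of \<open>C\<close> matches an eigenvalue in \<open>E'\<close>
        with an equal one in \<open>E\<close>; equal cardinalities then give equality.\<close>
      have "E' \<subseteq> E"
      proof
        fix a assume "a \<in> E'"
        then obtain j where j: "j < n" "a = enum n E' j"
          using bij_betw_imp_surj_on[OF bij_betw_enum[OF E']] by auto
        then obtain i where "i < n" "enum n E' j = enum n E i"
          using intertwiner_column(1)[OF m p CU cop e' e CD j(1)] by blast
        then show "a \<in> E" using j bij_betwE[OF bij_betw_enum[OF E]] by auto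
      qed
      moreover have "finite E" "card E' = card E"
        using E E' by (auto simp: spectra_def intro: finite_subset)
      ultimately have EE: "E' = E" by (intro card_subset_eq) auto
      have "C \<in> torus n m"
        using intertwiner_in_torus[OF m p CU cop e good] CD EE by simp
      then show "y \<in> (\<lambda>t. (mult_zmod m P t, E)) ` torus n m"
        using y EE PC by auto
    qed
    then have "card {y \<in> ?X. ?f y = ?f x} \<le> card (torus n m)"
      by (rule surj_card_le[OF finite_subset[OF torus_subset_Units[OF m] finite_Units_zmod_mats]])
    \<comment> \<open>The crude bound by all residues suffices, since the proportion of units tends
      to 1.\<close>
    also have "\<dots> \<le> card {0..<int m} ^ n"
      unfolding card_torus by (intro power_mono card_mono) auto
    finally show ?thesis by simp
  qed
  then have "card ?X \<le> m ^ n * card (?f ` ?X)" by (rule card_le_fibre_card_mult_image[OF fin])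
  also have "\<dots> \<le> m ^ n * card (Diag_zmod n m)"
  proof (intro mult_le_mono2 card_mono finite_Diag_zmod)
    show "?f ` ?X \<subseteq> Diag_zmod n m" unfolding Diag_zmod_eq[OF m] using enum_in by force
  qed
  finally have 1: "card (Units ?G) * card (spectra n m - ?bad) \<le> m ^ n * card (Diag_zmod n m)"
    by (simp only: card_cartesian_product)
  have bad: "?bad \<subseteq> spectra n m" by blast
  \<comment> \<open>Distinct bad sets have distinct enumerations, each of which is a
    collision.\<close>
  have "card ?bad \<le> card (residue_collisions p m n)"
    by (rule card_inj_on_le[of "enum n"])
      (use inj_on_subset[OF inj_on_enum bad] finite_residue_collisions in auto)
  moreover have "card (spectra n m - ?bad) = card (spectra n m) - card ?bad"
    by (rule card_Diff_subset[OF finite_subset[OF bad finite_spectra] bad])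
  ultimately have "(m choose n) \<le> card (spectra n m - ?bad) + card (residue_collisions p m n)"
    by (simp add: card_spectra)
  then have "card (Units ?G) * (m choose n) \<le>
      card (Units ?G) * (card (spectra n m - ?bad) + card (residue_collisions p m n))"
    by (rule mult_le_mono2)
  with 1 show ?thesis by (simp add: distrib_left)
qed

text \<open>Every residue is a unit or a multiple of \<open>p\<close>, and the multiples of
  \<open>p\<close> all share one residue modulo \<open>p\<close>.\<close>

lemma card_coprime_residues_ge:
  fixes p q :: nat
  assumes p: "p > 0" and cop: "\<And>x. \<not> int p dvd x \<Longrightarrow> coprime x (int (p * q))"
  shows "p * (p * q) \<le> p * card {x \<in> {0..<int (p * q)}. coprime x (int (p * q))} + p * q"
proof -
  let ?V = "{0..<int (p * q)}"
  let ?N = "{x \<in> ?V. int p dvd x}" and ?U = "{x \<in> ?V. coprime x (int (p * q))}"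
  have "p * q = card ?V" by (simp add: nat_mult_distrib)
  also have "\<dots> \<le> card (?U \<union> ?N)"
  proof (rule card_mono)
    show "finite (?U \<union> ?N)" by (rule finite_subset[of _ ?V]) auto
    show "?V \<subseteq> ?U \<union> ?N" using cop by blast
  qed
  also have "\<dots> \<le> card ?U + card ?N" by (rule card_Un_le)
  finally have "p * (p * q) \<le> p * (card ?U + card ?N)" by (rule mult_le_mono2)
  also have "\<dots> \<le> p * card ?U + p * q"
    unfolding distrib_left
    by (intro add_left_mono card_same_residue_le[OF p]) (auto intro: dvd_diff)
  finally show ?thesis .
qed

section \<open>The limit\<close>

text \<open>The quotient is a product of the \<open>n\<close> factors \<open>1 - i / m\<close>,
  divided by \<open>n!\<close>, and each factor tends to 1.\<close>

lemma binomial_over_power_tendsto: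
  "((\<lambda>m. real (m choose n) / real m ^ n) \<longlongrightarrow> 1 / fact n) at_top"
proof -
  have "((\<lambda>m. (\<Prod>i=0..<n. 1 - real i / real m) / fact n) \<longlongrightarrow> (\<Prod>i=0..<n. 1 - 0) / fact n) at_top"
    by (intro tendsto_intros tendsto_divide_0[OF tendsto_const]
        filterlim_at_top_imp_at_infinity filterlim_real_sequentially) auto
  moreover have "\<forall>\<^sub>F m in at_top. (\<Prod>i=0..<n. 1 - real i / real m) / fact n = real (m choose n) / real m ^ n"
    using eventually_gt_at_top[of 0]
  proof eventually_elim
    case (elim m)
    have "(\<Prod>i=0..<n. 1 - real i / real m) = (\<Prod>i=0..<n. (real m - real i) / real m)"
      using elim by (intro prod.cong) (auto simp: field_simps)
    also have "\<dots> = (\<Prod>i=0..<n. real m - real i) / real m ^ n" by (simp add: prod_dividef)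
    finally show ?case by (simp add: binomial_gbinomial gbinomial_prod_rev)
  qed
  ultimately show ?thesis by (simp add: filterlim_cong)
qed

text \<open>The integer estimates, divided by powers of \<open>m\<close>. Apart from
  \<open>c\<close>, the bounds depend only on \<open>n\<close> and \<open>p\<close>.\<close>

lemma Diag_zmod_density_bounds:
  fixes n k p :: nat
  assumes k: "k \<ge> 1" and p: "prime p" and pn: "p \<ge> n"
  defines "c \<equiv> real (p ^ k choose n) / real (p ^ k) ^ n"
    and "\<delta> \<equiv> real (card (Diag_zmod n (p ^ k))) / real (card (mat_zmod n (p ^ k)))"
  shows "(1 - real n / real p) * (c - real (n * n) / real p) \<le> \<delta>"
    and "\<delta> \<le> (c + real (n * n) / real p) / (1 - 1 / real p) ^ n"
proof -
  \<comment> \<open>Splitting off one factor \<open>p\<close>, possible as \<open>k\<close> is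
    positive, gives the shape \<open>p * q\<close> of the counting lemmas.\<close>
  define q where "q = p ^ (k - 1)"
  define m where "m = p * q"
  have mk: "p ^ k = m" using k by (simp add: m_def q_def power_eq_if)
  note p0 = prime_gt_0_nat[OF p] and p1 = prime_gt_1_nat[OF p]
  have q0: "q > 0" and m0: "m > 0" using p0 by (simp_all add: m_def q_def)
  have cop: "coprime x (int m)" if "\<not> int p dvd x" for x
  proof -
    have "coprime (int p) x" using p that by (intro prime_imp_coprime) auto
    then show ?thesis unfolding mk[symmetric] by (simp add: coprime_commute)
  qed
  have cop': "coprime x (int (p * q))" if "\<not> int p dvd x" for x
    using cop[OF that] by (simp add: m_def)
  have pm: "p dvd m" by (simp add: m_def)
  define U where "U = card (Units (zmod_mats n m))"
  define R where "R = card (residue_collisions p m n)"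
  define u where "u = card {x \<in> {0..<int m}. coprime x (int m)}"
  define M where "M = real m ^ n"
  define N where "N = real m ^ (n * n)"
  have MN: "M > 0" "N > 0" using m0 by (simp_all add: M_def N_def)
  have rp: "real p > 0" using p0 by simp
  have c: "c = real (m choose n) / M" by (simp add: c_def mk M_def)
  have \<delta>: "\<delta> = real (card (Diag_zmod n m)) / N" by (simp add: \<delta>_def mk card_mat_zmod N_def)
  have "real (p * R) \<le> real (n * n * m ^ n)"
    using card_residue_collisions_le[OF p0, of q n] by (simp only: R_def m_def of_nat_le_iff)
  then have R: "real R / M \<le> real (n * n) / real p"
    using MN rp by (simp add: M_def field_simps)
  have "real (p * m) \<le> real (p * u + m)"
    unfolding u_def m_def of_nat_le_iff by (rule card_coprime_residues_ge[OF p0]) (rule cop')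
  then have u: "1 - 1 / real p \<le> real u / real m" using rp m0 by (simp add: field_simps)
  have "real (p * m ^ (n * n)) \<le> real (p * U + n * m ^ (n * n))"
    unfolding U_def m_def of_nat_le_iff by (rule card_Units_zmod_mats_ge[OF p q0]) (rule cop')
  then have U: "1 - real n / real p \<le> real U / N" using rp MN by (simp add: N_def field_simps)
  have "real (U * (m choose n)) \<le> real (m ^ n * card (Diag_zmod n m) + U * R)"
    unfolding U_def R_def of_nat_le_iff by (rule Diag_zmod_lower[OF m0 p pm]) (rule cop)
  then have "real U * (real (m choose n) - real R) \<le> M * real (card (Diag_zmod n m))"
    by (simp add: M_def algebra_simps)
  then have "real U * (real (m choose n) - real R) / (M * N) \<le> M * real (card (Diag_zmod n m)) / (M * N)"
    using MN by (intro divide_right_mono) auto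
  then have low: "real U / N * (c - real R / M) \<le> \<delta>"
    using MN by (simp add: c \<delta> diff_divide_distrib right_diff_distrib mult.commute)
  have "real (u ^ n * card (Diag_zmod n m)) \<le> real (m ^ (n * n) * ((m choose n) + R))"
    using Diag_zmod_upper[OF m0 p0, of n] by (simp only: u_def R_def of_nat_le_iff)
  then have "real u ^ n * (\<delta> * N) \<le> N * (real (m choose n) + real R)"
    using MN by (simp add: \<delta> N_def)
  then have "real u ^ n * \<delta> \<le> real (m choose n) + real R"
    using MN by (simp add: mult.commute[of _ N] mult.left_commute[of _ N])
  then have up: "(real u / real m) ^ n * \<delta> \<le> c + real R / M"
    using MN by (simp add: c M_def field_simps)
  have \<delta>0: "\<delta> \<ge> 0" by (simp add: \<delta>_def)
  show "(1 - real n / real p) * (c - real (n * n) / real p) \<le> \<delta>"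
  proof (cases "c - real (n * n) / real p \<ge> 0")
    case True
    have "(1 - real n / real p) * (c - real (n * n) / real p) \<le> real U / N * (c - real R / M)"
      using U R True MN by (intro mult_mono) auto
    then show ?thesis using low by linarith
  next
    case False
    \<comment> \<open>Here \<open>p \<ge> n\<close> enters: a negative second factor then makes the
      product nonpositive, below any density.\<close>
    have "1 - real n / real p \<ge> 0" using pn rp by simp
    then have "(1 - real n / real p) * (c - real (n * n) / real p) \<le> 0"
      using False by (intro mult_nonneg_nonpos) auto
    then show ?thesis using \<delta>0 by linarith
  qed
  have r: "1 - 1 / real p > 0" using p1 by simp
  have "(1 - 1 / real p) ^ n * \<delta> \<le> (real u / real m) ^ n * \<delta>"
    using u r \<delta>0 by (intro mult_right_mono power_mono) auto
  also have "\<dots> \<le> c + real (n * n) / real p" using up R by linarith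
  finally show "\<delta> \<le> (c + real (n * n) / real p) / (1 - 1 / real p) ^ n"
    using r by (simp add: pos_le_divide_eq mult.commute)
qed

theorem theorem8p1:
  fixes n k :: nat
  assumes "n \<ge> 1" and "k \<ge> 1"
  shows "((\<lambda>p::nat. real (card (Diag_zmod n (p ^ k))) / real (card (mat_zmod n (p ^ k))))
           \<longlongrightarrow> 1 / fact n) (inf at_top (principal {p. prime p}))"
proof -
  let ?F = "inf at_top (principal {p::nat. prime p})"
  let ?c = "\<lambda>p. real (p ^ k choose n) / real (p ^ k) ^ n"
  have ev: "\<forall>\<^sub>F p in ?F. prime p \<and> p \<ge> n"
    unfolding eventually_inf_principal by (rule eventually_mono[OF eventually_ge_at_top[of n]]) simp
  \<comment> \<open>The binomial limit is in the modulus, so the modulus itself must tend to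
    infinity with \<open>p\<close>.\<close>
  have "LIM p at_top. p ^ k :> (at_top :: nat filter)"
  proof (rule filterlim_at_top_mono[OF filterlim_ident])
    show "\<forall>\<^sub>F p :: nat in at_top. p \<le> p ^ k"
      by (rule eventually_mono[OF eventually_ge_at_top[of 1]]) (use assms(2) in \<open>simp add: self_le_power\<close>)
  qed
  from filterlim_compose[OF binomial_over_power_tendsto this]
  have c: "(?c \<longlongrightarrow> 1 / fact n) ?F"
    by (rule tendsto_mono[rotated]) simp
  have inv: "((\<lambda>p. a / real p) \<longlongrightarrow> 0) ?F" for a
    by (rule tendsto_mono[OF inf_le1])
      (intro tendsto_divide_0[OF tendsto_const] filterlim_at_top_imp_at_infinity filterlim_real_sequentially)
  show ?thesis
  \<comment> \<open>Both density bounds tend to \<open>1 / n!\<close>; they hold eventually along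
    the filter, for primes \<open>p \<ge> n\<close>.\<close>
  proof (rule tendsto_sandwich)
    show "\<forall>\<^sub>F p in ?F. (1 - real n / real p) * (?c p - real (n * n) / real p)
        \<le> real (card (Diag_zmod n (p ^ k))) / real (card (mat_zmod n (p ^ k)))"
      using ev by eventually_elim (use Diag_zmod_density_bounds(1)[OF assms(2)] in blast)
    show "\<forall>\<^sub>F p in ?F. real (card (Diag_zmod n (p ^ k))) / real (card (mat_zmod n (p ^ k)))
        \<le> (?c p + real (n * n) / real p) / (1 - 1 / real p) ^ n"
      using ev by eventually_elim (use Diag_zmod_density_bounds(2)[OF assms(2)] in blast)
    have "((\<lambda>p. (1 - real n / real p) * (?c p - real (n * n) / real p)) \<longlongrightarrow> (1 - 0) * (1 / fact n - 0)) ?F"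
      by (intro tendsto_intros c inv)
    then show "((\<lambda>p. (1 - real n / real p) * (?c p - real (n * n) / real p)) \<longlongrightarrow> 1 / fact n) ?F" by simp
    have "((\<lambda>p. (?c p + real (n * n) / real p) / (1 - 1 / real p) ^ n) \<longlongrightarrow> (1 / fact n + 0) / (1 - 0) ^ n) ?F"
      by (intro tendsto_intros c inv) simp
    then show "((\<lambda>p. (?c p + real (n * n) / real p) / (1 - 1 / real p) ^ n) \<longlongrightarrow> 1 / fact n) ?F" by simp
  qed
qed

end
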